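(* Let $d\ge2$ be an integer and let $R_1(z)=\sum_j(z-\lambda_j)_+$ be the first Riesz-mean of the Laplacian eigenvalues $\lambda_j$ (counted with multiplicity) on $\mathbb{S}^d$. For all $z>0$, $$ R_1(z)\geq L_{1,d}^{class}|\mathbb{S}^d|\,z^{\frac d2+1}\left(1+\frac{d(d-2)(d+2)}{12z}\right). $$
   Context: $\mathbb{S}^d$ is the round unit sphere in $\mathbb{R}^{d+1}$. The distinct eigenvalues (energy levels) of $-\Delta$ on $\mathbb{S}^d$ are $\lambda_{(l)}=l(l+d-1)$, $l\in\mathbb{N}=\{0,1,2,\dots\}$, with multiplicity $m_{l,d}=\binom{d+l}{l}-\binom{d+l-2}{l-2}$ (a binomial coefficient with negative lower entry being $0$); $a_+=\max(a,0)$. The semiclassical constant is $L_{\gamma,d}^{class}=(4\pi)^{-d/2}\frac{\Gamma(\gamma+1)}{\Gamma(\gamma+1+d/2)}$, so $L_{1,d}^{class}|\mathbb{S}^d|=\frac{4}{(d+2)\,d!}$. *)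

theory Defs
  imports "HOL-Analysis.Analysis" "HOL-Library.Function_Algebras"
begin

definition partial :: "'n::finite \<Rightarrow> (real^'n \<Rightarrow> real) \<Rightarrow> real^'n \<Rightarrow> real" where
  "partial i F x = frechet_derivative F (at x) (axis i 1)"

definition C2_on :: "(real^'n::finite) set \<Rightarrow> (real^'n \<Rightarrow> real) \<Rightarrow> bool" where
  "C2_on U F \<longleftrightarrow>
     (\<forall>x\<in>U. F differentiable (at x)) \<and>
     (\<forall>i. \<forall>x\<in>U. partial i F differentiable (at x)) \<and>
     (\<forall>i j. continuous_on U (partial j (partial i F)))"

definition laplacian :: "(real^'n::finite \<Rightarrow> real) \<Rightarrow> real^'n \<Rightarrow> real" where
  "laplacian F x = (\<Sum>i\<in>UNIV. partial i (partial i F) x)"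

text \<open>
  The Laplace-Beltrami operator of the round unit sphere: \<open>f\<close> is extended to the punctured
  space by homogeneity of degree 0, and the Euclidean Laplacian of the extension is
  restricted to the sphere. Only the values of \<open>f\<close> on the unit sphere enter.
\<close>

definition radial_extension :: "(real^'n::finite \<Rightarrow> real) \<Rightarrow> real^'n \<Rightarrow> real" where
  "radial_extension f x = f (x /\<^sub>R norm x)"

definition sphere_C2 :: "(real^'n::finite \<Rightarrow> real) \<Rightarrow> bool" where
  "sphere_C2 f \<longleftrightarrow> C2_on (- {0}) (radial_extension f)"

definition sphere_laplacian :: "(real^'n::finite \<Rightarrow> real) \<Rightarrow> real^'n \<Rightarrow> real" where
  "sphere_laplacian f x = laplacian (radial_extension f) x"

text \<open>
  A function on the sphere is represented by its extension by 0 to the whole space, so that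
  equality and linear independence of representatives agree with those on the sphere.
\<close>

definition sphere_eigenspace :: "real \<Rightarrow> (real^'n::finite \<Rightarrow> real) set" where
  "sphere_eigenspace \<mu> =
     {f. (\<forall>x. x \<notin> sphere 0 1 \<longrightarrow> f x = 0) \<and> sphere_C2 f \<and>
         (\<forall>x\<in>sphere 0 1. - sphere_laplacian f x = \<mu> * f x)}"

definition sphere_eigenvalues :: "'n::finite itself \<Rightarrow> real set" where
  "sphere_eigenvalues _ = {\<mu>. \<exists>f \<in> sphere_eigenspace \<mu> :: (real^'n \<Rightarrow> real) set. f \<noteq> (\<lambda>x. 0)}"

global_interpretation real_fun: vector_space "\<lambda>(c::real) (f::'x \<Rightarrow> real) x. c * f x"
  by unfold_locales (auto simp: fun_eq_iff algebra_simps)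

text \<open>
  The dimension of the eigenspace, as a value in \<open>enat\<close>: the function \<open>dim\<close> of the library
  would silently return 0 on an infinite-dimensional space.
\<close>

definition sphere_multiplicity :: "'n::finite itself \<Rightarrow> real \<Rightarrow> enat" where
  "sphere_multiplicity _ \<mu> =
     (SUP B \<in> {B :: (real^'n \<Rightarrow> real) set.
         finite B \<and> B \<subseteq> sphere_eigenspace \<mu> \<and> real_fun.independent B}. enat (card B))"

text \<open>
  The Riesz mean is a sum of nonnegative terms and is therefore taken in \<open>ennreal\<close>, where it
  is always meaningful.
\<close>

definition sphere_riesz_mean1 :: "'n::finite itself \<Rightarrow> real \<Rightarrow> ennreal" where
  "sphere_riesz_mean1 T z =
     (\<Sum>\<^sub>\<infinity>\<mu>\<in>sphere_eigenvalues T.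
        ennreal_of_enat (sphere_multiplicity T \<mu>) * ennreal (max (z - \<mu>) 0))"

definition semiclassical_const :: "real \<Rightarrow> nat \<Rightarrow> real" where
  "semiclassical_const \<gamma> d =
     (4 * pi) powr (- real d / 2) * (Gamma (\<gamma> + 1) / Gamma (\<gamma> + 1 + real d / 2))"

text \<open>
  The surface measure on the unit sphere in its polar-coordinate form: the dimension of the
  ambient space times the volume of the cone with apex 0 over the given set.
\<close>

definition sphere_surface_measure :: "(real^'n::finite) set \<Rightarrow> real" where
  "sphere_surface_measure A =
     real CARD('n) * measure lebesgue {t *\<^sub>R x | t x. t \<in> {0..1} \<and> x \<in> A}"

definition unit_sphere_area :: "'n::finite itself \<Rightarrow> real" where
  "unit_sphere_area _ = sphere_surface_measure (sphere (0 :: real^'n) 1)"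

end

theory Submission
  imports Defs "HOL-Library.Multiset"
begin

text \<open>
  The Riesz mean is a sum of nonnegative terms, so it can be bounded below by any finite
  part of the spectrum and by any lower bound on the multiplicities. It is therefore enough to
  exhibit, for each degree \<open>l\<close>, as many independent spherical harmonics as the classical
  multiplicity asks for.

  \<^emph>\<open>Multiplicities.\<close> A homogeneous harmonic polynomial of degree \<open>l\<close> in \<open>d + 1\<close> variables
  restricts to an eigenfunction on the sphere with eigenvalue \<open>l (l + d - 1)\<close>
  (\<open>form_in_eigenspace\<close>). Single out one variable. The equation that the Laplacian vanishes
  is a recursion in the exponent of this variable, so the coefficients of the monomials in
  which this exponent is 0 or 1 can be prescribed and determine the others. This is the
  Cauchy problem for the Laplace equation with polynomial data. It gives one harmonic
  polynomial for each such monomial, and they are independent because their prescribed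
  coefficients are (\<open>eigenspace_independent_set\<close>). Counting the monomials gives the classical
  multiplicity \<open>m\<^sub>l\<close>.

  \<^emph>\<open>Reduction to the eigenvalues.\<close> Between two consecutive eigenvalues the partial sum
  \<open>\<Sum>k. m\<^sub>k (z - \<lambda>\<^sub>k)\<close> is affine in \<open>z\<close>, whereas the asserted lower bound is convex: it is a
  nonnegative combination of \<open>z powr (d/2 + 1)\<close> and \<open>z powr (d/2)\<close>. A convex function lies
  below its chords, so it suffices to compare the two at the eigenvalues.

  \<^emph>\<open>At an eigenvalue\<close> \<open>\<lambda> = l (l + d - 1)\<close> the sum telescopes to
  \<open>4 / ((d + 2) d!) * l (l + 1) \<dots> (l + d - 1) * (\<lambda> + d (d - 2) / 4)\<close> (\<open>riesz_sum_at_node\<close>).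
  Pairing the factor \<open>l + j\<close> with \<open>l + d - 1 - j\<close> shows that the square of the product is
  \<open>\<Prod>j<d. (\<lambda> + a j)\<close> with \<open>a j = j (d - 1 - j)\<close>. Since \<open>\<Sum>j<d. a j = d (d - 1) (d - 2) / 6\<close>,
  expansion in \<open>1/\<lambda>\<close> yields exactly the first correction
  \<open>d (d - 1) (d - 2) / 12 + d (d - 2) / 4 = d (d - 2) (d + 2) / 12\<close>; the second-order terms
  have the right sign because no single \<open>a j\<close> exceeds \<open>d (d - 2) / 2\<close>
  (\<open>node_inequality_scaled\<close>). Finally \<open>4 / ((d + 2) d!)\<close> is the semiclassical constant times
  the area of the sphere, by the duplication formula for the Gamma function at half-integers.
\<close>

section \<open>Gradients and second derivatives on open sets\<close>

text \<open>
  The partial derivatives are carried along explicitly, so that second derivatives of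
  products can be computed by rewriting.
\<close>

definition has_gradient_on where
  "has_gradient_on F G U \<longleftrightarrow>
     (\<forall>x\<in>U. (F has_derivative (\<lambda>h. \<Sum>i\<in>UNIV. G i x * h $ i)) (at x))"
  for F :: "real^'n::finite \<Rightarrow> real" and G :: "'n \<Rightarrow> real^'n \<Rightarrow> real"

lemma has_gradient_on_partial:
  assumes "has_gradient_on F G U" "x \<in> U"
  shows "partial i F x = G i x"
proof -
  have "(F has_derivative (\<lambda>h. \<Sum>j\<in>UNIV. G j x * h $ j)) (at x)"
    using assms by (simp add: has_gradient_on_def)
  then have "frechet_derivative F (at x) = (\<lambda>h. \<Sum>j\<in>UNIV. G j x * h $ j)"
    by (rule frechet_derivative_at[symmetric])
  then show ?thesis
    by (simp add: partial_def axis_def if_distrib cong: if_cong)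
qed

lemma has_gradient_on_cong:
  assumes "has_gradient_on F G U" "open U" "\<And>x. x \<in> U \<Longrightarrow> F' x = F x"
    "\<And>i x. x \<in> U \<Longrightarrow> G' i x = G i x"
  shows "has_gradient_on F' G' U"
  unfolding has_gradient_on_def
proof
  fix x assume x: "x \<in> U"
  have "(F has_derivative (\<lambda>h. \<Sum>i\<in>UNIV. G i x * h $ i)) (at x)"
    using assms x by (simp add: has_gradient_on_def)
  then have "(F' has_derivative (\<lambda>h. \<Sum>i\<in>UNIV. G i x * h $ i)) (at x)"
    by (rule has_derivative_transform_within_open[OF _ assms(2) x]) (simp add: assms)
  then show "(F' has_derivative (\<lambda>h. \<Sum>i\<in>UNIV. G' i x * h $ i)) (at x)"
    using x assms by simp
qed

lemma has_gradient_on_subset: "has_gradient_on F G U \<Longrightarrow> V \<subseteq> U \<Longrightarrow> has_gradient_on F G V"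
  by (auto simp: has_gradient_on_def)

lemma has_gradient_on_differentiable:
  "has_gradient_on F G U \<Longrightarrow> x \<in> U \<Longrightarrow> F differentiable (at x)"
  unfolding has_gradient_on_def differentiable_def by blast

lemma has_gradient_on_const: "has_gradient_on (\<lambda>x. c) (\<lambda>i x. 0) U"
  by (simp add: has_gradient_on_def)

lemma has_gradient_on_coord: "has_gradient_on (\<lambda>x. x $ j) (\<lambda>i x. of_bool (i = j)) U"
proof -
  have "((\<lambda>x. x $ j) has_derivative (\<lambda>h. h $ j)) (at x)" for x :: "real^'a"
    by (rule bounded_linear_imp_has_derivative, rule bounded_linear_vec_nth)
  then show ?thesis
    by (simp add: has_gradient_on_def)
qed

lemma has_gradient_on_add:
  assumes "has_gradient_on F G U" "has_gradient_on F' G' U"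
  shows "has_gradient_on (\<lambda>x. F x + F' x) (\<lambda>i x. G i x + G' i x) U"
  using assms unfolding has_gradient_on_def
  by (auto simp: algebra_simps sum.distrib intro!: has_derivative_add)

lemma has_gradient_on_mult:
  assumes "has_gradient_on F G U" "has_gradient_on F' G' U"
  shows "has_gradient_on (\<lambda>x. F x * F' x) (\<lambda>i x. F x * G' i x + G i x * F' x) U"
  unfolding has_gradient_on_def
proof
  fix x assume "x \<in> U"
  then have "(F has_derivative (\<lambda>h. \<Sum>i\<in>UNIV. G i x * h $ i)) (at x)"
    "(F' has_derivative (\<lambda>h. \<Sum>i\<in>UNIV. G' i x * h $ i)) (at x)"
    using assms by (auto simp: has_gradient_on_def)
  from has_derivative_mult[OF this]
  show "((\<lambda>x. F x * F' x) has_derivative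
      (\<lambda>h. \<Sum>i\<in>UNIV. (F x * G' i x + G i x * F' x) * h $ i)) (at x)"
    by (simp add: sum_distrib_left sum_distrib_right sum.distrib algebra_simps)
qed

lemma has_gradient_on_cmult:
  "has_gradient_on F G U \<Longrightarrow> has_gradient_on (\<lambda>x. c * F x) (\<lambda>i x. c * G i x) U"
  using has_gradient_on_mult[OF has_gradient_on_const[of c]] by simp

lemma has_gradient_on_sum:
  assumes "\<And>a. a \<in> A \<Longrightarrow> has_gradient_on (F a) (G a) U"
  shows "has_gradient_on (\<lambda>x. \<Sum>a\<in>A. F a x) (\<lambda>i x. \<Sum>a\<in>A. G a i x) U"
  using assms
proof (induction A rule: infinite_finite_induct)
  case (insert a A)
  then show ?case using has_gradient_on_add[of "F a" "G a" U] by simp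
qed (simp_all add: has_gradient_on_const)

lemma has_gradient_on_inner_powr:
  "has_gradient_on (\<lambda>x. (x \<bullet> x) powr s) (\<lambda>i x. 2 * s * x $ i * (x \<bullet> x) powr (s - 1)) (- {0})"
  unfolding has_gradient_on_def
proof
  fix x :: "real^'n" assume "x \<in> - {0}"
  then have pos: "x \<bullet> x > 0" by simp
  have "((\<lambda>x. x \<bullet> x) has_derivative (\<lambda>h. 2 * (x \<bullet> h))) (at x)"
    by (auto intro!: derivative_eq_intros simp: inner_commute)
  from has_derivative_powr[OF this has_derivative_const[of s] pos]
  have "((\<lambda>x. (x \<bullet> x) powr s) has_derivative
          (\<lambda>h. (x \<bullet> x) powr s * (2 * (x \<bullet> h) * s / (x \<bullet> x)))) (at x)"
    by simp
  moreover have "(x \<bullet> x) powr s * (2 * (x \<bullet> h) * s / (x \<bullet> x)) =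
      (\<Sum>i\<in>UNIV. 2 * s * x $ i * (x \<bullet> x) powr (s - 1) * h $ i)" for h
  proof -
    have "(\<Sum>i\<in>UNIV. 2 * s * x $ i * (x \<bullet> x) powr (s - 1) * h $ i)
        = 2 * s * (x \<bullet> x) powr (s - 1) * (\<Sum>i\<in>UNIV. x $ i * h $ i)"
      by (simp add: sum_distrib_left algebra_simps)
    also have "(\<Sum>i\<in>UNIV. x $ i * h $ i) = x \<bullet> h" by (simp add: inner_vec_def)
    finally show ?thesis using pos by (simp add: powr_diff field_simps)
  qed
  ultimately show "((\<lambda>x. (x \<bullet> x) powr s) has_derivative
      (\<lambda>h. \<Sum>i\<in>UNIV. 2 * s * x $ i * (x \<bullet> x) powr (s - 1) * h $ i)) (at x)"
    by simp
qed

lemma laplacian_via_gradients: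
  assumes "open U" "x \<in> U" "has_gradient_on F G U" "\<And>i. has_gradient_on (G i) (H i) U"
    and eq: "\<And>x. x \<in> U \<Longrightarrow> F' x = F x"
  shows "laplacian F' x = (\<Sum>i\<in>UNIV. H i i x)"
proof -
  have F': "has_gradient_on F' G U"
    by (rule has_gradient_on_cong[OF assms(3,1)]) (auto simp: eq)
  have P: "has_gradient_on (partial i F') (H i) U" for i
    by (rule has_gradient_on_cong[OF assms(4,1)]) (auto simp: has_gradient_on_partial[OF F'])
  show ?thesis
    unfolding laplacian_def using has_gradient_on_partial[OF P assms(2)] by simp
qed

text \<open>
  A class of functions that is closed under partial derivatives on the punctured space and
  contains the radial extensions of all spherical harmonics. Membership gives differentiability
  of every order without computing any derivative.
\<close>

inductive elementary :: "(real^'n::finite \<Rightarrow> real) \<Rightarrow> bool" where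
  elementary_const: "elementary (\<lambda>x. c)"
| elementary_coord: "elementary (\<lambda>x. x $ i)"
| elementary_powr: "elementary (\<lambda>x. (x \<bullet> x) powr s)"
| elementary_add: "elementary F \<Longrightarrow> elementary G \<Longrightarrow> elementary (\<lambda>x. F x + G x)"
| elementary_mult: "elementary F \<Longrightarrow> elementary G \<Longrightarrow> elementary (\<lambda>x. F x * G x)"

lemma elementary_gradient:
  assumes "elementary F"
  shows "\<exists>G. has_gradient_on F G (- {0}) \<and> (\<forall>i. elementary (G i))"
  using assms
proof induction
  case (elementary_const c)
  show ?case
    using has_gradient_on_const by (intro exI[of _ "\<lambda>i x. 0"]) (auto intro: elementary.elementary_const)
next
  case (elementary_coord i)
  show ?case
    using has_gradient_on_coord
    by (intro exI[of _ "\<lambda>j x. of_bool (j = i)"]) (auto intro: elementary.elementary_const)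
next
  case (elementary_powr s)
  then show ?case
    using has_gradient_on_inner_powr[of s]
    by (intro exI[of _ "\<lambda>i x. 2 * s * x $ i * (x \<bullet> x) powr (s - 1)"])
      (auto intro!: elementary.intros)
next
  case (elementary_add F G)
  then obtain G1 G2 where "has_gradient_on F G1 (- {0})" "\<forall>i. elementary (G1 i)"
    "has_gradient_on G G2 (- {0})" "\<forall>i. elementary (G2 i)" by blast
  then show ?case
    using has_gradient_on_add[of F G1 "- {0}" G G2]
    by (intro exI[of _ "\<lambda>i x. G1 i x + G2 i x"]) (auto intro!: elementary.intros)
next
  case (elementary_mult F G)
  then obtain G1 G2 where "has_gradient_on F G1 (- {0})" "\<forall>i. elementary (G1 i)"
    "has_gradient_on G G2 (- {0})" "\<forall>i. elementary (G2 i)" by blast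
  with elementary_mult.hyps show ?case
    using has_gradient_on_mult[of F G1 "- {0}" G G2]
    by (intro exI[of _ "\<lambda>i x. F x * G2 i x + G1 i x * G x"]) (auto intro!: elementary.intros)
qed

lemma elementary_sum:
  "(\<And>a. a \<in> A \<Longrightarrow> elementary (F a)) \<Longrightarrow> elementary (\<lambda>x. \<Sum>a\<in>A. F a x)"
  by (induction A rule: infinite_finite_induct) (auto intro: elementary.intros)

lemma elementary_imp_C2_on:
  assumes "elementary F" and eq: "\<And>x. x \<noteq> 0 \<Longrightarrow> F' x = F x"
  shows "C2_on (- {0}) F'"
proof -
  have op: "open (- {0 :: real^'a})" by auto
  obtain G where G: "has_gradient_on F G (- {0})" "\<And>i. elementary (G i)"
    using elementary_gradient[OF assms(1)] by blast
  obtain H where H: "\<And>i. has_gradient_on (G i) (H i) (- {0})" "\<And>i j. elementary (H i j)"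
    using elementary_gradient[OF G(2)] by metis
  have F': "has_gradient_on F' G (- {0})"
    by (rule has_gradient_on_cong[OF G(1) op]) (auto simp: eq)
  have P: "has_gradient_on (partial i F') (H i) (- {0})" for i
    by (rule has_gradient_on_cong[OF H(1) op]) (auto simp: has_gradient_on_partial[OF F'])
  have "continuous_on (- {0}) (H i j)" for i j
  proof -
    obtain K where "has_gradient_on (H i j) K (- {0})"
      using elementary_gradient[OF H(2)] by blast
    then show ?thesis
      by (auto intro!: differentiable_imp_continuous_on differentiable_at_imp_differentiable_on
          has_gradient_on_differentiable)
  qed
  then have "continuous_on (- {0}) (partial j (partial i F'))" for i j
    by (rule continuous_on_eq) (simp add: has_gradient_on_partial[OF P])
  then show ?thesis
    unfolding C2_on_def using has_gradient_on_differentiable[OF F'] has_gradient_on_differentiable[OF P]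
    by blast
qed

section \<open>Homogeneous polynomials\<close>

text \<open>
  Exponents are multisets of variables: the degree is the size, and a derivative removes one
  element.
\<close>

definition monomial :: "'n::finite multiset \<Rightarrow> real^'n \<Rightarrow> real" where
  "monomial \<alpha> x = (\<Prod>i\<in>#\<alpha>. x $ i)"

lemma monomial_empty [simp]: "monomial {#} x = 1"
  and monomial_add_mset [simp]: "monomial (add_mset i \<alpha>) x = x $ i * monomial \<alpha> x"
  by (simp_all add: monomial_def)

lemma monomial_scaleR: "monomial \<alpha> (t *\<^sub>R x) = t ^ size \<alpha> * monomial \<alpha> x"
  by (induction \<alpha>) (auto simp: algebra_simps)

lemma elementary_monomial: "elementary (monomial \<alpha>)"
proof (induction \<alpha>)
  case empty
  then show ?case using elementary_const[of 1] by (simp add: monomial_def)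
next
  case (add i \<alpha>)
  have "monomial (add_mset i \<alpha>) = (\<lambda>x. x $ i * monomial \<alpha> x)" by auto
  with add show ?case by (auto intro!: elementary.intros)
qed

lemma coord_monomial_remove: "real (count \<alpha> i) * (x $ i * monomial (\<alpha> - {#i#}) x) = real (count \<alpha> i) * monomial \<alpha> x"
proof (cases "i \<in># \<alpha>")
  case True
  then obtain \<beta> where "\<alpha> = add_mset i \<beta>" by (meson multi_member_split)
  then show ?thesis by simp
next
  case False
  then show ?thesis by (simp add: not_in_iff)
qed

lemma has_gradient_on_monomial:
  "has_gradient_on (monomial \<alpha>) (\<lambda>i x. real (count \<alpha> i) * monomial (\<alpha> - {#i#}) x) UNIV"
proof (induction \<alpha>)
  case empty
  then show ?case
    using has_gradient_on_const[of 1 UNIV] by (simp add: has_gradient_on_def)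
next
  case (add j \<alpha>)
  from has_gradient_on_mult[OF has_gradient_on_coord[of j UNIV] this]
  show ?case
  proof (rule has_gradient_on_cong)
    fix i x
    show "real (count (add_mset j \<alpha>) i) * monomial (add_mset j \<alpha> - {#i#}) x =
      x $ j * (real (count \<alpha> i) * monomial (\<alpha> - {#i#}) x) + of_bool (i = j) * monomial \<alpha> x"
    proof (cases "i = j")
      case True
      then show ?thesis using coord_monomial_remove[of \<alpha> i x] by (auto simp: algebra_simps)
    next
      case False
      then show ?thesis
        by (cases "i \<in># \<alpha>") (simp_all add: not_in_iff)
    qed
  qed auto
qed

definition form :: "nat \<Rightarrow> ('n::finite multiset \<Rightarrow> real) \<Rightarrow> real^'n \<Rightarrow> real" where
  "form l c x = (\<Sum>\<alpha>\<in>multisets_of_size UNIV l. c \<alpha> * monomial \<alpha> x)"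

lemma form_scaleR: "form l c (t *\<^sub>R x) = t ^ l * form l c x"
  by (simp add: form_def monomial_scaleR multisets_of_size_def sum_distrib_left algebra_simps)

lemma elementary_form: "elementary (form l c)"
proof -
  have "form l c = (\<lambda>x. \<Sum>\<alpha>\<in>multisets_of_size UNIV l. c \<alpha> * monomial \<alpha> x)"
    by (auto simp: form_def)
  then show ?thesis
    by (auto intro!: elementary_sum elementary_monomial elementary_mult elementary_const)
qed

lemma sum_form: "(\<Sum>a\<in>A. form l (c a) x) = form l (\<lambda>\<beta>. \<Sum>a\<in>A. c a \<beta>) x"
  unfolding form_def by (subst sum.swap) (simp add: sum_distrib_right)

text \<open>
  Partial derivatives, taken monomial by monomial. Where the variable \<open>i\<close> does not occur in
  \<open>\<alpha>\<close>, the weight \<open>count \<alpha> i\<close> is 0, so the value of \<open>\<alpha> - {#i#}\<close> is immaterial.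
\<close>

definition form_d1 where
  "form_d1 l c i x = (\<Sum>\<alpha>\<in>multisets_of_size UNIV l. c \<alpha> * (real (count \<alpha> i) * monomial (\<alpha> - {#i#}) x))"

definition form_d2 where
  "form_d2 l c i j x = (\<Sum>\<alpha>\<in>multisets_of_size UNIV l. c \<alpha> * (real (count \<alpha> i) *
     (real (count (\<alpha> - {#i#}) j) * monomial (\<alpha> - {#i#} - {#j#}) x)))"

lemma has_gradient_on_form: "has_gradient_on (form l c) (form_d1 l c) UNIV"
  unfolding form_def form_d1_def
  by (intro has_gradient_on_sum has_gradient_on_cmult has_gradient_on_monomial)

lemma has_gradient_on_form_d1: "has_gradient_on (form_d1 l c i) (form_d2 l c i) UNIV"
  unfolding form_d1_def form_d2_def
  by (intro has_gradient_on_sum has_gradient_on_cmult has_gradient_on_monomial)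

text \<open>
  Euler's identity for homogeneous functions: each monomial is reproduced once for every
  element of its exponent.
\<close>

lemma euler_form: "(\<Sum>i\<in>UNIV. x $ i * form_d1 l c i x) = real l * form l c x"
proof -
  have "(\<Sum>i\<in>UNIV. x $ i * form_d1 l c i x) =
    (\<Sum>\<alpha>\<in>multisets_of_size UNIV l. \<Sum>i\<in>UNIV. c \<alpha> * (real (count \<alpha> i) * (x $ i * monomial (\<alpha> - {#i#}) x)))"
    unfolding form_d1_def
    by (subst sum.swap) (simp add: sum_distrib_left mult_ac)
  also have "\<dots> = (\<Sum>\<alpha>\<in>multisets_of_size UNIV l. (\<Sum>i\<in>UNIV. real (count \<alpha> i)) * (c \<alpha> * monomial \<alpha> x))"
    by (simp only: coord_monomial_remove sum_distrib_right) (simp add: mult_ac)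
  also have "\<dots> = (\<Sum>\<alpha>\<in>multisets_of_size UNIV l. real l * (c \<alpha> * monomial \<alpha> x))"
  proof (rule sum.cong)
    fix \<alpha> :: "'a multiset" assume "\<alpha> \<in> multisets_of_size UNIV l"
    then have "l = (\<Sum>i\<in>set_mset \<alpha>. count \<alpha> i)"
      by (simp add: multisets_of_size_def size_multiset_overloaded_eq)
    also have "\<dots> = (\<Sum>i\<in>UNIV. count \<alpha> i)"
      by (rule sum.mono_neutral_left) (auto simp: not_in_iff)
    finally show "(\<Sum>i\<in>UNIV. real (count \<alpha> i)) * (c \<alpha> * monomial \<alpha> x) = real l * (c \<alpha> * monomial \<alpha> x)"
      by simp
  qed simp
  finally show ?thesis by (simp add: form_def sum_distrib_left)
qed

text \<open>
  The coefficients of the partial derivative of a form, as a form of degree one less.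
\<close>

definition deriv_coeff :: "'n \<Rightarrow> ('n multiset \<Rightarrow> real) \<Rightarrow> 'n multiset \<Rightarrow> real" where
  "deriv_coeff i c \<beta> = real (count \<beta> i + 1) * c (add_mset i \<beta>)"

lemma form_d1_0: "form_d1 0 c i x = 0"
  by (simp add: form_d1_def)

lemma form_d1_Suc: "form_d1 (Suc l) c i x = form l (deriv_coeff i c) x"
proof -
  have "form_d1 (Suc l) c i x =
    (\<Sum>\<alpha>\<in>add_mset i ` multisets_of_size UNIV l. c \<alpha> * (real (count \<alpha> i) * monomial (\<alpha> - {#i#}) x))"
    unfolding form_d1_def
  proof (rule sum.mono_neutral_right)
    show "finite (multisets_of_size UNIV (Suc l) :: 'a multiset set)"
      by (rule finite_multisets_of_size) simp
    show "add_mset i ` multisets_of_size UNIV l \<subseteq> multisets_of_size UNIV (Suc l)"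
      by (auto simp: multisets_of_size_def)
    show "\<forall>\<alpha>\<in>multisets_of_size UNIV (Suc l) - add_mset i ` multisets_of_size UNIV l.
          c \<alpha> * (real (count \<alpha> i) * monomial (\<alpha> - {#i#}) x) = 0"
    proof
      fix \<alpha> :: "'a multiset"
      assume a: "\<alpha> \<in> multisets_of_size UNIV (Suc l) - add_mset i ` multisets_of_size UNIV l"
      have "i \<notin># \<alpha>"
      proof
        assume "i \<in># \<alpha>"
        then obtain \<beta> where "\<alpha> = add_mset i \<beta>" by (meson multi_member_split)
        with a show False by (auto simp: multisets_of_size_def)
      qed
      then show "c \<alpha> * (real (count \<alpha> i) * monomial (\<alpha> - {#i#}) x) = 0"
        by (simp add: not_in_iff)
    qed
  qed
  also have "\<dots> = form l (deriv_coeff i c) x"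
    by (subst sum.reindex) (auto simp: inj_on_def form_def deriv_coeff_def mult_ac)
  finally show ?thesis .
qed

lemma form_d2_0: "form_d2 0 c i j x = 0"
  by (simp add: form_d2_def)

lemma form_d2_Suc: "form_d2 (Suc l) c i j x = form_d1 l (deriv_coeff i c) j x"
  using has_gradient_on_partial[OF has_gradient_on_form_d1, of x j "Suc l" c i]
    has_gradient_on_partial[OF has_gradient_on_form, of x j l "deriv_coeff i c"]
  by (simp add: form_d1_Suc[abs_def] ext)

text \<open>
  Induction on the degree: if a form vanishes, so do its partial derivatives, whose
  coefficients are nonzero multiples of the original ones.
\<close>

lemma form_eq_0_imp_coeff_eq_0:
  assumes "\<And>x. x \<noteq> 0 \<Longrightarrow> form l c x = 0" "size \<alpha> = l"
  shows "c \<alpha> = 0"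
  using assms
proof (induction l arbitrary: c \<alpha>)
  case 0
  have "form 0 c (axis (undefined :: 'a) 1) = c {#}" by (simp add: form_def)
  with 0 show ?case by (auto simp: axis_eq_0_iff)
next
  case (Suc l)
  obtain i \<beta> where \<alpha>: "\<alpha> = add_mset i \<beta>" using Suc.prems(2) by (cases \<alpha>) auto
  have "form l (deriv_coeff i c) x = 0" if "x \<noteq> 0" for x
  proof -
    have "has_gradient_on (form (Suc l) c) (\<lambda>_ _. 0) (- {0})"
      by (rule has_gradient_on_cong[OF has_gradient_on_const[of 0]]) (auto simp: Suc.prems)
    then have "form_d1 (Suc l) c i x = 0"
      using that has_gradient_on_partial has_gradient_on_partial[OF has_gradient_on_form]
      by (metis ComplI UNIV_I singletonD)
    then show ?thesis by (simp add: form_d1_Suc)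
  qed
  from Suc.IH[of "deriv_coeff i c" \<beta>, OF this] Suc.prems(2) \<alpha>
  have "deriv_coeff i c \<beta> = 0" by simp
  then show ?case by (simp add: deriv_coeff_def \<alpha>)
qed

section \<open>Harmonic polynomials and their restriction to the sphere\<close>

lemma deriv_coeff_twice:
  "deriv_coeff i (deriv_coeff i c) \<beta> =
     real (count \<beta> i + 1) * real (count \<beta> i + 2) * c (\<beta> + {#i, i#})"
  by (simp add: deriv_coeff_def mult_ac)

lemma form_harmonic:
  assumes "\<And>\<beta>. (\<Sum>i\<in>UNIV. deriv_coeff i (deriv_coeff i c) \<beta>) = 0"
  shows "(\<Sum>i\<in>UNIV. form_d2 l c i i x) = 0"
proof -
  consider "l = 0" | "l = Suc 0" | k where "l = Suc (Suc k)" by (metis not0_implies_Suc)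
  then show ?thesis
  proof cases
    case 3
    then show ?thesis
      by (simp add: form_d2_Suc form_d1_Suc sum_form assms) (simp add: form_def)
  qed (simp_all add: form_d2_0 form_d2_Suc form_d1_0)
qed

text \<open>
  For an exponent \<open>\<gamma>\<close> that contains the variable \<open>i0\<close> at most once: the coefficients of the
  harmonic form in which \<open>\<gamma>\<close> is the only such exponent. The recursion solves the equation that the Laplacian vanishes for the
  coefficient with the highest power of \<open>i0\<close>.
\<close>

function harmonic_coeff :: "'n::finite \<Rightarrow> 'n multiset \<Rightarrow> 'n multiset \<Rightarrow> real" where
  "harmonic_coeff i0 \<gamma> \<alpha> =
     (if count \<alpha> i0 \<le> 1 then of_bool (\<alpha> = \<gamma>)
      else - (\<Sum>i\<in>UNIV - {i0}. real (count \<alpha> i + 1) * real (count \<alpha> i + 2) *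
                 harmonic_coeff i0 \<gamma> (\<alpha> - {#i0, i0#} + {#i, i#})) /
             (real (count \<alpha> i0 - 1) * real (count \<alpha> i0)))"
  by auto
termination by (relation "Wellfounded.measure (\<lambda>(i0, \<gamma>, \<alpha>). count \<alpha> i0)") auto

declare harmonic_coeff.simps [simp del]

lemma harmonic_coeff_initial: "count \<alpha> i0 \<le> 1 \<Longrightarrow> harmonic_coeff i0 \<gamma> \<alpha> = of_bool (\<alpha> = \<gamma>)"
  by (subst harmonic_coeff.simps) simp

lemma harmonic_coeff_harmonic:
  "(\<Sum>i\<in>UNIV. deriv_coeff i (deriv_coeff i (harmonic_coeff i0 \<gamma>)) \<beta>) = 0"
proof -
  let ?t = "\<lambda>i. deriv_coeff i (deriv_coeff i (harmonic_coeff i0 \<gamma>)) \<beta>"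
  let ?\<alpha> = "\<beta> + {#i0, i0#}"
  have "harmonic_coeff i0 \<gamma> ?\<alpha> =
     - (\<Sum>i\<in>UNIV - {i0}. real (count ?\<alpha> i + 1) * real (count ?\<alpha> i + 2) *
                 harmonic_coeff i0 \<gamma> (?\<alpha> - {#i0, i0#} + {#i, i#})) /
             (real (count ?\<alpha> i0 - 1) * real (count ?\<alpha> i0))"
    by (subst harmonic_coeff.simps) simp
  also have "(\<Sum>i\<in>UNIV - {i0}. real (count ?\<alpha> i + 1) * real (count ?\<alpha> i + 2) *
                 harmonic_coeff i0 \<gamma> (?\<alpha> - {#i0, i0#} + {#i, i#})) = (\<Sum>i\<in>UNIV - {i0}. ?t i)"
    by (rule sum.cong) (auto simp: deriv_coeff_twice)
  finally have "?t i0 = - (\<Sum>i\<in>UNIV - {i0}. ?t i)"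
    unfolding deriv_coeff_twice[of i0] by (simp add: divide_simps mult_ac del: of_nat_add of_nat_Suc)
  then show ?thesis by (simp add: sum.remove[of UNIV i0])
qed

definition on_sphere :: "(real^'n::finite \<Rightarrow> real) \<Rightarrow> real^'n \<Rightarrow> real" where
  "on_sphere F x = (if norm x = 1 then F x else 0)"

lemma radial_extension_form:
  assumes "x \<noteq> 0"
  shows "radial_extension (on_sphere (form l c)) x = (x \<bullet> x) powr (- real l / 2) * form l c x"
proof -
  have "(x \<bullet> x) powr (- real l / 2) = norm x powr (- real l)"
  proof -
    have "x \<bullet> x = norm x powr 2" using assms by (simp add: dot_square_norm powr_numeral)
    then show ?thesis by (simp only: powr_powr) simp
  qed
  also have "\<dots> = inverse (norm x) ^ l"
    using assms by (simp add: powr_minus powr_realpow power_inverse)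
  finally have "(x \<bullet> x) powr (- real l / 2) = inverse (norm x) ^ l" .
  then show ?thesis
    using assms by (simp add: radial_extension_def on_sphere_def form_scaleR)
qed

text \<open>
  With \<open>u = (x \<bullet> x) powr (- l / 2)\<close>, the radial extension is the product of \<open>u\<close> and the form.
  In the product rule for its Laplacian the term with the Laplacian of the form vanishes, the
  mixed term is evaluated by Euler's identity, and the Laplacian of \<open>u\<close> is explicit.
\<close>

lemma form_in_eigenspace:
  fixes c :: "'n::finite multiset \<Rightarrow> real"
  assumes harm: "\<And>\<beta>. (\<Sum>i\<in>UNIV. deriv_coeff i (deriv_coeff i c) \<beta>) = 0"
  shows "on_sphere (form l c) \<in> sphere_eigenspace (real l * (real l + real CARD('n) - 2))"
proof -
  define s where "s = - real l / 2"
  define u where "u s x = (x \<bullet> x) powr s" for s and x :: "real^'n"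
  define H where "H = form l c"
  define D where "D = form_d1 l c"
  have gu: "has_gradient_on (u s) (\<lambda>i x. 2 * s * (x $ i * u (s - 1) x)) (- {0})" for s
    using has_gradient_on_inner_powr[of s] unfolding u_def by (simp add: mult_ac)
  have gH: "has_gradient_on H D (- {0})"
    unfolding H_def D_def using has_gradient_on_form has_gradient_on_subset by blast
  have gD: "has_gradient_on (D i) (form_d2 l c i) (- {0})" for i
    unfolding D_def using has_gradient_on_form_d1 has_gradient_on_subset by blast
  have "sphere_C2 (on_sphere H)"
    unfolding sphere_C2_def H_def
    by (rule elementary_imp_C2_on[OF elementary_mult[OF elementary_powr elementary_form]
          radial_extension_form])
  moreover have "- sphere_laplacian (on_sphere H) x =
      real l * (real l + real CARD('n) - 2) * on_sphere H x" if x: "norm x = 1" for x :: "real^'n"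
  proof -
    define n where "n = real CARD('n)"
    have xx: "x \<bullet> x = 1" using x by (simp add: dot_square_norm)
    have u1: "u t x = 1" for t by (simp add: u_def xx)
    have x0: "x \<in> - {0}" using x by auto
    \<comment> \<open>First and second partial derivatives of the product; the order of the summands is that of
      the product rule.\<close>
    note gF = has_gradient_on_mult[OF gu[of s] gH]
    note gG = has_gradient_on_add[OF has_gradient_on_mult[OF gu[of s] gD]
             has_gradient_on_mult[OF has_gradient_on_cmult[OF
               has_gradient_on_mult[OF has_gradient_on_coord gu[of "s - 1"]], of "2 * s"] gH]]
    have "sphere_laplacian (on_sphere H) x =
      (\<Sum>i\<in>UNIV. u s x * form_d2 l c i i x + 2 * s * (x $ i * u (s - 1) x) * D i x +
        (2 * s * (x $ i * u (s - 1) x) * D i x +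
          2 * s * (x $ i * (2 * (s - 1) * (x $ i * u (s - 1 - 1) x)) + of_bool (i = i) * u (s - 1) x) * H x))"
      unfolding sphere_laplacian_def
    proof (rule laplacian_via_gradients[OF _ x0 gF gG])
      show "radial_extension (on_sphere H) x = u s x * H x" if "x \<in> - {0}" for x
        using that by (simp add: H_def u_def s_def radial_extension_form)
    qed auto
    also have "\<dots> = (\<Sum>i\<in>UNIV. form_d2 l c i i x + 4 * s * (x $ i * D i x) +
        (4 * s * (s - 1) * (x $ i * x $ i) + 2 * s) * H x)"
      by (rule sum.cong) (auto simp: u1 algebra_simps)
    also have "\<dots> = (\<Sum>i\<in>UNIV. form_d2 l c i i x) + 4 * s * (\<Sum>i\<in>UNIV. x $ i * D i x)
        + (4 * s * (s - 1) * (\<Sum>i\<in>UNIV. x $ i * x $ i) + 2 * s * n) * H x"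
      by (simp only: sum.distrib sum_distrib_left[symmetric] sum_distrib_right[symmetric])
        (simp add: n_def mult_ac)
    also have "(\<Sum>i\<in>UNIV. x $ i * x $ i) = 1"
      using xx by (simp add: inner_vec_def)
    also have "(\<Sum>i\<in>UNIV. x $ i * D i x) = real l * H x"
      unfolding D_def H_def by (rule euler_form)
    also have "(\<Sum>i\<in>UNIV. form_d2 l c i i x) = 0"
      by (rule form_harmonic[OF harm])
    finally have "sphere_laplacian (on_sphere H) x = - (real l * (real l + n - 2)) * H x"
      by (simp add: s_def algebra_simps)
    then show ?thesis using x by (simp add: n_def on_sphere_def)
  qed
  ultimately show ?thesis
    unfolding H_def sphere_eigenspace_def by (auto simp: on_sphere_def)
qed

section \<open>The multiplicities\<close>

text \<open>
  By homogeneity a form that vanishes on the sphere vanishes everywhere off the origin, hence so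
  do its coefficients.
\<close>

lemma sum_on_sphere_form_eq_0:
  fixes c :: "'a \<Rightarrow> 'n::finite multiset \<Rightarrow> real"
  assumes "(\<Sum>a\<in>A. (\<lambda>x. u a * on_sphere (form l (c a)) x)) = 0" "size \<alpha> = l"
  shows "(\<Sum>a\<in>A. u a * c a \<alpha>) = 0"
proof -
  have "form l (\<lambda>\<alpha>. \<Sum>a\<in>A. u a * c a \<alpha>) x = 0" if "x \<noteq> 0" for x
  proof -
    define y where "y = x /\<^sub>R norm x"
    have y: "norm y = 1" using that by (simp add: y_def)
    have ev: "(\<Sum>a\<in>A. F a) y = (\<Sum>a\<in>A. F a y)" for F :: "'a \<Rightarrow> real^'n \<Rightarrow> real"
      by (induction A rule: infinite_finite_induct) auto
    have "0 = (\<Sum>a\<in>A. (\<lambda>x. u a * on_sphere (form l (c a)) x)) y"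
      using assms(1) by simp
    also have "\<dots> = (\<Sum>a\<in>A. u a * form l (c a) y)"
      using y by (simp add: ev on_sphere_def)
    also have "\<dots> = (\<Sum>a\<in>A. form l (\<lambda>\<alpha>. u a * c a \<alpha>) y)"
      by (simp add: form_def sum_distrib_left mult_ac)
    also have "\<dots> = form l (\<lambda>\<alpha>. \<Sum>a\<in>A. u a * c a \<alpha>) y" by (rule sum_form)
    finally show ?thesis using that by (simp add: y_def form_scaleR)
  qed
  from form_eq_0_imp_coeff_eq_0[OF this assms(2)] show ?thesis by simp
qed

text \<open>
  The classical multiplicity in Pascal-reduced form: the two summands count the monomials of
  degree \<open>l\<close> in which one fixed variable has exponent 0 and 1, respectively.
\<close>

definition harmonic_dim :: "nat \<Rightarrow> nat \<Rightarrow> nat" where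
  "harmonic_dim d l = (d + l - 1 choose l) + (if l = 0 then 0 else d + l - 2 choose (l - 1))"

lemma card_initial_exponents:
  fixes i0 :: "'n::finite"
  assumes "CARD('n) = d + 1"
  shows "card {\<gamma> \<in> multisets_of_size UNIV l. count \<gamma> i0 \<le> 1} = harmonic_dim d l"
proof -
  let ?M = "multisets_of_size (UNIV - {i0})"
  have cM: "card (?M k) = (d + k - 1) choose k" for k
    using assms by (subst card_multisets_of_size) (auto simp: card_Diff_singleton)
  have fM: "finite (?M k)" for k by (rule finite_multisets_of_size) simp
  show ?thesis
  proof (cases l)
    case 0
    have "{\<gamma> \<in> multisets_of_size UNIV 0. count \<gamma> i0 \<le> 1} = {{#}}" by auto
    then show ?thesis by (simp add: 0 harmonic_dim_def)
  next
    case (Suc k)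
    have "{\<gamma> \<in> multisets_of_size UNIV l. count \<gamma> i0 \<le> 1} = ?M l \<union> add_mset i0 ` ?M k"
    proof (intro equalityI subsetI)
      fix \<gamma> assume "\<gamma> \<in> {\<gamma> \<in> multisets_of_size UNIV l. count \<gamma> i0 \<le> 1}"
      then have g: "size \<gamma> = l" "count \<gamma> i0 \<le> 1" by (auto simp: multisets_of_size_def)
      show "\<gamma> \<in> ?M l \<union> add_mset i0 ` ?M k"
      proof (cases "i0 \<in># \<gamma>")
        case True
        then obtain \<beta> where b: "\<gamma> = add_mset i0 \<beta>" by (meson multi_member_split)
        with g have "i0 \<notin># \<beta>" by (simp add: not_in_iff)
        with b g Suc show ?thesis by (auto simp: multisets_of_size_def)
      next
        case False
        with g show ?thesis by (auto simp: multisets_of_size_def)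
      qed
    next
      fix \<gamma> assume "\<gamma> \<in> ?M l \<union> add_mset i0 ` ?M k"
      then show "\<gamma> \<in> {\<gamma> \<in> multisets_of_size UNIV l. count \<gamma> i0 \<le> 1}"
        using Suc by (auto simp: multisets_of_size_def not_in_iff subset_Diff_insert)
    qed
    moreover have "?M l \<inter> add_mset i0 ` ?M k = {}" by (auto simp: multisets_of_size_def)
    moreover have "card (add_mset i0 ` ?M k) = card (?M k)" by (rule card_image) (auto simp: inj_on_def)
    ultimately show ?thesis
      using Suc by (simp add: card_Un_disjoint fM cM harmonic_dim_def)
  qed
qed

text \<open>
  A relation between the harmonic forms is tested on the coefficient of each prescribed
  monomial, where exactly one of the forms contributes.
\<close>

lemma eigenspace_independent_set:
  assumes "CARD('n::finite) = d + 1"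
  shows "\<exists>B :: (real^'n \<Rightarrow> real) set. finite B \<and>
     B \<subseteq> sphere_eigenspace (real l * (real l + real d - 1)) \<and>
     real_fun.independent B \<and> card B = harmonic_dim d l"
proof -
  define i0 :: 'n where "i0 = undefined"
  define \<Gamma> where "\<Gamma> = {\<gamma> \<in> multisets_of_size UNIV l. count \<gamma> i0 \<le> 1}"
  define Y where "Y \<gamma> = on_sphere (form l (harmonic_coeff i0 \<gamma>))" for \<gamma>
  have fin: "finite \<Gamma>" unfolding \<Gamma>_def
    by (rule finite_subset[OF _ finite_multisets_of_size[of UNIV l]]) auto
  have indep: "u \<gamma> = 0" if "(\<Sum>\<gamma>\<in>\<Gamma>. (\<lambda>x. u \<gamma> * Y \<gamma> x)) = 0" "\<gamma> \<in> \<Gamma>" for u \<gamma>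
  proof -
    from \<open>\<gamma> \<in> \<Gamma>\<close> have g: "size \<gamma> = l" "count \<gamma> i0 \<le> 1"
      by (auto simp: \<Gamma>_def multisets_of_size_def)
    have "(\<Sum>\<gamma>'\<in>\<Gamma>. u \<gamma>' * harmonic_coeff i0 \<gamma>' \<gamma>) = 0"
      using that(1) g(1) unfolding Y_def by (rule sum_on_sphere_form_eq_0)
    also have "(\<Sum>\<gamma>'\<in>\<Gamma>. u \<gamma>' * harmonic_coeff i0 \<gamma>' \<gamma>) = (\<Sum>\<gamma>'\<in>\<Gamma>. if \<gamma> = \<gamma>' then u \<gamma>' else 0)"
      using g(2) by (intro sum.cong) (auto simp: harmonic_coeff_initial)
    finally show ?thesis using that(2) fin by simp
  qed
  have inj: "inj_on Y \<Gamma>"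
  proof (rule inj_onI, rule ccontr)
    fix \<alpha> \<beta> assume ab: "\<alpha> \<in> \<Gamma>" "\<beta> \<in> \<Gamma>" "Y \<alpha> = Y \<beta>" "\<alpha> \<noteq> \<beta>"
    \<comment> \<open>Two equal forms would satisfy the relation with coefficients 1 and \<open>- 1\<close>.\<close>
    define u :: "'n multiset \<Rightarrow> real" where "u \<gamma> = (if \<gamma> = \<alpha> then 1 else if \<gamma> = \<beta> then - 1 else 0)" for \<gamma>
    have "(\<Sum>\<gamma>\<in>\<Gamma>. (\<lambda>x. u \<gamma> * Y \<gamma> x)) = (\<Sum>\<gamma>\<in>{\<alpha>, \<beta>}. (\<lambda>x. u \<gamma> * Y \<gamma> x))"
      using ab fin by (intro sum.mono_neutral_right) (auto simp: u_def fun_eq_iff)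
    also have "\<dots> = 0" using ab by (simp add: u_def fun_eq_iff)
    finally have "u \<alpha> = 0" using ab(1) by (rule indep)
    then show False by (simp add: u_def)
  qed
  have "real_fun.independent (Y ` \<Gamma>)"
  proof
    assume "real_fun.dependent (Y ` \<Gamma>)"
    then obtain u \<gamma> where u: "\<gamma> \<in> \<Gamma>" "u (Y \<gamma>) \<noteq> 0"
      "(\<Sum>v\<in>Y ` \<Gamma>. (\<lambda>x. u v * v x)) = 0"
      using real_fun.dependent_finite[of "Y ` \<Gamma>"] fin by auto
    have "(\<Sum>\<gamma>\<in>\<Gamma>. (\<lambda>x. u (Y \<gamma>) * Y \<gamma> x)) = 0"
      using u(3) by (simp add: sum.reindex[OF inj] o_def)
    from indep[OF this u(1)] u(2) show False by simp
  qed
  moreover have "Y ` \<Gamma> \<subseteq> sphere_eigenspace (real l * (real l + real d - 1))"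
  proof -
    have "Y \<gamma> \<in> sphere_eigenspace (real l * (real l + real CARD('n) - 2))" for \<gamma>
      unfolding Y_def by (rule form_in_eigenspace[OF harmonic_coeff_harmonic])
    moreover have "real l * (real l + real CARD('n) - 2) = real l * (real l + real d - 1)"
      using assms by simp
    ultimately show ?thesis by auto
  qed
  moreover have "card (Y ` \<Gamma>) = harmonic_dim d l"
    using card_image[OF inj] card_initial_exponents[OF assms] by (simp add: \<Gamma>_def)
  ultimately show ?thesis using fin by blast
qed

text \<open>
  Only the eigenvalues of degree below \<open>L\<close> are kept, each with the multiplicity that has been
  exhibited. Where \<open>z\<close> lies below the eigenvalue, replacing the positive part by the difference
  lowers the sum further.
\<close>

lemma riesz_mean_lower_bound:
  assumes d: "CARD('n::finite) = d + 1" and "d \<ge> 1"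
  shows "sphere_riesz_mean1 TYPE('n) z \<ge>
    ennreal (\<Sum>k<L. real (harmonic_dim d k) * (z - real k * (real k + real d - 1)))"
proof -
  define ev where "ev k = real k * (real k + real d - 1)" for k
  let ?m = "sphere_multiplicity TYPE('n)"
  let ?f = "\<lambda>\<mu>. ennreal_of_enat (?m \<mu>) * ennreal (max (z - \<mu>) 0)"
  have mult: "enat (harmonic_dim d k) \<le> ?m (ev k)" for k
  proof -
    obtain B :: "(real^'n \<Rightarrow> real) set" where B: "finite B" "B \<subseteq> sphere_eigenspace (ev k)"
     "real_fun.independent B" "card B = harmonic_dim d k"
      using eigenspace_independent_set[OF d] unfolding ev_def by metis
    show ?thesis unfolding sphere_multiplicity_def
      by (rule SUP_upper2[of B]) (use B in auto)
  qed
  have pos: "harmonic_dim d k > 0" for k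
    using \<open>d \<ge> 1\<close> by (simp add: harmonic_dim_def) arith
  have eig: "ev k \<in> sphere_eigenvalues TYPE('n)" for k
  proof -
    obtain B :: "(real^'n \<Rightarrow> real) set" where B: "finite B" "B \<subseteq> sphere_eigenspace (ev k)"
     "real_fun.independent B" "card B = harmonic_dim d k"
      using eigenspace_independent_set[OF d] unfolding ev_def by metis
    then obtain f where "f \<in> B" using pos[of k] by fastforce
    moreover have "f \<noteq> (\<lambda>x. 0)"
      using real_fun.dependent_zero[of B] B(3) \<open>f \<in> B\<close> by (auto simp: zero_fun_def)
    ultimately show ?thesis using B(2) by (auto simp: sphere_eigenvalues_def)
  qed
  have "strict_mono ev"
    using \<open>d \<ge> 1\<close> by (intro strict_monoI_Suc) (simp add: ev_def algebra_simps)
  then have inj: "inj_on ev {..<L}" by (meson inj_on_subset strict_mono_imp_inj_on subset_UNIV)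
  have "ennreal (\<Sum>k<L. real (harmonic_dim d k) * (z - ev k))
      \<le> ennreal (\<Sum>k<L. real (harmonic_dim d k) * max (z - ev k) 0)"
    by (intro ennreal_leI sum_mono mult_left_mono) auto
  also have "\<dots> = (\<Sum>k<L. ennreal_of_enat (enat (harmonic_dim d k)) * ennreal (max (z - ev k) 0))"
    by (subst sum_ennreal[symmetric]) (auto simp: ennreal_mult ennreal_of_nat_eq_real_of_nat)
  also have "\<dots> \<le> (\<Sum>k<L. ?f (ev k))"
    using mult by (intro sum_mono mult_right_mono) (simp_all only: ennreal_of_enat_le_iff zero_le)
  also have "\<dots> = infsum ?f (ev ` {..<L})"
    by (simp add: sum.reindex[OF inj])
  also have "\<dots> \<le> infsum ?f (sphere_eigenvalues TYPE('n))"
    by (rule infsum_mono_neutral) (use eig in \<open>auto intro!: nonneg_summable_on_complete\<close>)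
  finally show ?thesis by (simp add: sphere_riesz_mean1_def ev_def)
qed

section \<open>The Riesz sum at the eigenvalues\<close>

text \<open>
  The counting function of the eigenvalues: the product of the \<open>d - 1\<close> consecutive integers
  \<open>l + 1, \<dots>, l + d - 1\<close>, times twice their mean, divided by \<open>d!\<close>.
\<close>

lemma harmonic_dim_sum:
  assumes "d \<ge> 1"
  shows "(\<Sum>k\<le>l. real (harmonic_dim d k)) = (2 * real l + real d) * pochhammer (real l + 1) (d - 1) / fact d"
proof -
  obtain e where e: "d = Suc e" using assms by (cases d) auto
  have c: "pochhammer (real l + 1) e = fact (l + e) / fact l" for l
  proof -
    have "fact (l + e) = fact l * pochhammer (real l + 1) e"
      using pochhammer_product'[of "1::real" l e] by (simp add: pochhammer_fact add_ac)
    then show ?thesis by simp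
  qed
  show ?thesis
  proof (induction l)
    case 0
    then show ?case using c[of 0] by (simp add: e harmonic_dim_def)
  next
    case (Suc l)
    define F :: real where "F = fact (l + e)"
    define p :: real where "p = fact l"
    define r :: real where "r = fact e"
    have pr: "p > 0" "r > 0" by (auto simp: p_def r_def)
    have "real (e + Suc l choose Suc l) = fact (e + Suc l) / (fact (Suc l) * fact e)"
      by (subst binomial_fact) auto
    also have "\<dots> = (real e + real l + 1) * F / ((real l + 1) * p * r)"
      by (simp add: F_def p_def r_def algebra_simps)
    finally have b1: "real (e + Suc l choose Suc l) = (real e + real l + 1) * F / ((real l + 1) * p * r)" .
    have "real (e + l choose l) = fact (e + l) / (fact l * fact e)"
      by (subst binomial_fact) auto
    then have b2: "real (e + l choose l) = F / (p * r)" by (simp add: F_def p_def r_def add_ac)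
    have "harmonic_dim d (Suc l) = (e + Suc l choose Suc l) + (e + l choose l)"
      by (simp add: harmonic_dim_def e)
    then have h: "real (harmonic_dim d (Suc l)) =
        (real e + real l + 1) * F / ((real l + 1) * p * r) + F / (p * r)"
      by (simp only: of_nat_add b1 b2)
    have IH: "(\<Sum>k\<le>l. real (harmonic_dim d k)) = (2 * real l + real e + 1) * (F / p) / ((real e + 1) * r)"
      using Suc.IH c[of l] by (simp add: e F_def p_def r_def algebra_simps)
    have last_factor: "pochhammer (real (Suc l) + 1) (d - 1) / fact d =
        ((real e + real l + 1) * F / ((real l + 1) * p)) / ((real e + 1) * r)"
      using c[of "Suc l"] by (simp add: e F_def p_def r_def algebra_simps)
    have "(\<Sum>k\<le>Suc l. real (harmonic_dim d k)) =
      (2 * real l + real e + 1) * (F / p) / ((real e + 1) * r) +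
      ((real e + real l + 1) * F / ((real l + 1) * p * r) + F / (p * r))"
      by (simp only: sum.atMost_Suc IH h)
    also have "\<dots> = (2 * real l + real e + 3) *
        (((real e + real l + 1) * F / ((real l + 1) * p)) / ((real e + 1) * r))"
      using pr by (simp add: divide_simps add_nonneg_eq_0_iff) (simp add: algebra_simps)
    also have "\<dots> = (2 * real (Suc l) + real d) * (pochhammer (real (Suc l) + 1) (d - 1) / fact d)"
      unfolding last_factor by (simp add: e algebra_simps)
    finally show ?case by simp
  qed
qed

text \<open>
  Passing from one eigenvalue to the next adds the counting function times the spectral gap
  \<open>2 l + d\<close>, so the closed form follows by induction.
\<close>

lemma riesz_sum_at_node:
  assumes "d \<ge> 1"
  defines "ev k \<equiv> real k * (real k + real d - 1)"
  shows "(\<Sum>k<l. real (harmonic_dim d k) * (ev l - ev k)) =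
    4 / ((real d + 2) * fact d) * (pochhammer (real l) d * (ev l + real d * (real d - 2) / 4))"
proof (induction l)
  case 0
  then show ?case using assms by (simp add: pochhammer_0_left)
next
  case (Suc l)
  obtain e where e: "d = Suc e" using assms by (cases d) auto
  define Q where "Q = pochhammer (real l + 1) e"
  have P0: "pochhammer (real l) d = real l * Q"
    by (simp add: e pochhammer_rec Q_def)
  have P1: "pochhammer (real (Suc l)) d = (real l + real d) * Q"
    by (simp add: e pochhammer_rec' Q_def algebra_simps)
  have N: "(\<Sum>k\<le>l. real (harmonic_dim d k)) = (2 * real l + real d) * Q / fact d"
    using harmonic_dim_sum[OF assms(1)] by (simp add: e Q_def)
  have gap: "ev (Suc l) - ev l = 2 * real l + real d"
    by (simp add: ev_def algebra_simps)
  have "(\<Sum>k<Suc l. real (harmonic_dim d k) * (ev (Suc l) - ev k)) =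
     (\<Sum>k<Suc l. real (harmonic_dim d k) * (ev l - ev k)) + (\<Sum>k<Suc l. real (harmonic_dim d k)) * (ev (Suc l) - ev l)"
    by (simp only: sum_distrib_right sum.distrib[symmetric] distrib_left[symmetric]) simp
  also have "\<dots> = 4 / ((real d + 2) * fact d) * (real l * Q * (ev l + real d * (real d - 2) / 4))
     + (2 * real l + real d) * Q / fact d * (2 * real l + real d)"
    using Suc.IH N by (simp add: lessThan_Suc_atMost[symmetric] P0 gap)
  also have "\<dots> = 4 / ((real d + 2) * fact d) * (((real l + real d) * Q) * (ev (Suc l) + real d * (real d - 2) / 4))"
    by (simp add: ev_def divide_simps) (simp add: algebra_simps)
  finally show ?case by (simp only: P1)
qed

text \<open>
  The factors are paired symmetrically about the centre of the product:
  \<open>(x + j) (x + d - 1 - j) = x (x + d - 1) + j (d - 1 - j)\<close>.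
\<close>

lemma pochhammer_square:
  fixes x :: real
  shows "(pochhammer x d)\<^sup>2 = (\<Prod>j<d. x * (x + real d - 1) + real j * (real d - 1 - real j))"
proof -
  have "(\<Prod>j<d. x + real j) = (\<Prod>j<d. x + real (d - Suc j))"
    by (rule prod.nat_diff_reindex[symmetric])
  then have "(pochhammer x d)\<^sup>2 = (\<Prod>j<d. (x + real j) * (x + real (d - Suc j)))"
    by (simp add: pochhammer_prod atLeast0LessThan power2_eq_square prod.distrib)
  also have "\<dots> = (\<Prod>j<d. x * (x + real d - 1) + real j * (real d - 1 - real j))"
    by (rule prod.cong) (auto simp: of_nat_diff algebra_simps)
  finally show ?thesis .
qed

section \<open>The inequality at the eigenvalues\<close>

lemma sum_squares_le_square_sum:
  fixes a :: "'i \<Rightarrow> real"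
  assumes "\<And>i. i \<in> A \<Longrightarrow> a i \<ge> 0"
  shows "(\<Sum>i\<in>A. (a i)\<^sup>2) \<le> (sum a A)\<^sup>2"
  using assms
proof (induction A rule: infinite_finite_induct)
  case (insert i A)
  then have "0 \<le> 2 * a i * sum a A" by (auto intro!: mult_nonneg_nonneg sum_nonneg)
  with insert show ?case by (simp add: power2_sum)
qed auto

text \<open>
  The right-hand side is the part of the product of degree at most two in \<open>a\<close>; the second
  elementary symmetric polynomial is written with power sums.
\<close>

lemma prod_one_plus_ge:
  fixes a :: "'i \<Rightarrow> real"
  assumes "finite A" "\<And>i. i \<in> A \<Longrightarrow> a i \<ge> 0"
  shows "(\<Prod>i\<in>A. 1 + a i) \<ge> 1 + sum a A + ((sum a A)\<^sup>2 - (\<Sum>i\<in>A. (a i)\<^sup>2)) / 2"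
  using assms
proof (induction A)
  case (insert i A)
  let ?s = "sum a A" and ?q = "\<Sum>i\<in>A. (a i)\<^sup>2"
  have q: "?q \<le> ?s\<^sup>2"
    using insert.prems by (intro sum_squares_le_square_sum) auto
  have ai: "a i \<ge> 0" using insert.prems by simp
  have "(1 + a i) * (1 + ?s + (?s\<^sup>2 - ?q) / 2) \<le> (1 + a i) * (\<Prod>i\<in>A. 1 + a i)"
    using insert by (intro mult_left_mono) auto
  moreover have "0 \<le> a i * ((?s\<^sup>2 - ?q) / 2)" using q ai by simp
  ultimately show ?case
    using insert.hyps by (simp add: power2_eq_square algebra_simps add_divide_distrib diff_divide_distrib)
qed simp

lemma sum_index_products:
  "(\<Sum>j<d. real j * (real d - 1 - real j)) = real d * (real d - 1) * (real d - 2) / 6"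
proof -
  have "(\<Sum>j<n. real j * (c - real j)) = c * (real n * (real n - 1) / 2) - real n * (real n - 1) * (2 * real n - 1) / 6" for n c
    by (induction n) (auto simp: field_simps)
  from this[of "real d - 1" d] show ?thesis by (simp add: field_simps)
qed

text \<open>
  Here \<open>t\<close> stands for the reciprocal of the eigenvalue. The terms of degree at most one in \<open>t\<close>
  agree, because half of the sum of the \<open>j (d - 1 - j)\<close> plus \<open>d (d - 2) / 4\<close> is the coefficient on
  the right. Squaring avoids a case distinction on the parity of \<open>d\<close>.
\<close>

lemma node_inequality_scaled:
  fixes t :: real
  assumes "t \<ge> 0" "d \<ge> 2"
  shows "(\<Prod>j<d. 1 + t * (real j * (real d - 1 - real j))) * (1 + real d * (real d - 2) / 4 * t)\<^sup>2
     \<ge> (1 + real d * (real d - 2) * (real d + 2) / 12 * t)\<^sup>2"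
proof -
  define a where "a j = t * (real j * (real d - 1 - real j))" for j
  define s where "s = (\<Sum>j<d. a j)"
  define q where "q = (\<Sum>j<d. (a j)\<^sup>2)"
  define b where "b = real d * (real d - 2) / 4 * t"
  have a0: "a j \<ge> 0" if "j < d" for j using that assms by (auto simp: a_def)
  have s: "s = real d * (real d - 1) * (real d - 2) / 6 * t"
    unfolding s_def a_def sum_distrib_left[symmetric] sum_index_products by simp
  have s0: "s \<ge> 0" and b0: "b \<ge> 0" using assms by (auto simp: s b_def)
  \<comment> \<open>The second-order condition: each \<open>a j\<close> is at most \<open>(d - 1)\<^sup>2 t / 4\<close>, hence at most \<open>2 * b\<close> as
    soon as \<open>d \<ge> 3\<close>; for \<open>d = 2\<close> all \<open>a j\<close> vanish.\<close>
  have q: "q \<le> 2 * s * b"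
  proof (cases "d = 2")
    case True
    then have "q = 0" by (simp add: q_def a_def eval_nat_numeral)
    then show ?thesis using s0 b0 by simp
  next
    case False
    then have d3: "real d \<ge> 3" using assms by linarith
    have "a j \<le> 2 * b" if "j < d" for j
    proof -
      have "real j * (real d - 1 - real j) \<le> (real d - 1)\<^sup>2 / 4"
        using zero_le_power2[of "2 * real j - (real d - 1)"] by (simp add: power2_eq_square algebra_simps)
      also have "\<dots> \<le> real d * (real d - 2) / 2"
      proof -
        have "2 * 2 \<le> (real d - 1) * (real d - 1)" using d3 by (intro mult_mono) auto
        then show ?thesis by (simp add: power2_eq_square field_simps)
      qed
      finally show ?thesis
        using mult_left_mono[OF _ assms(1)] unfolding a_def b_def by fastforce
    qed
    then have "q \<le> (\<Sum>j<d. a j * (2 * b))"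
      unfolding q_def power2_eq_square using a0 by (intro sum_mono mult_left_mono) auto
    also have "\<dots> = 2 * s * b" by (simp add: s_def sum_distrib_left sum_distrib_right mult_ac)
    finally show ?thesis .
  qed
  have "(1 + (s / 2 + b))\<^sup>2 \<le> (1 + s + (s\<^sup>2 - q) / 2) * (1 + b)\<^sup>2"
  proof -
    define E where "E = (s\<^sup>2 - q) / 2"
    have E0: "E \<ge> 0"
      unfolding E_def s_def q_def using sum_squares_le_square_sum[of "{..<d}" a] a0 by auto
    have "1 \<le> (1 + b)\<^sup>2" using b0 by (simp add: power2_eq_square algebra_simps)
    from mult_left_mono[OF this E0] have "(1 + s) * (1 + b)\<^sup>2 + E \<le> (1 + s + E) * (1 + b)\<^sup>2"
      by (simp add: algebra_simps)
    moreover have "(1 + s) * (1 + b)\<^sup>2 = 1 + 2 * b + b\<^sup>2 + s + 2 * s * b + s * b\<^sup>2"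
      by (simp add: power2_eq_square algebra_simps)
    moreover have "(1 + (s / 2 + b))\<^sup>2 = 1 + s + 2 * b + s\<^sup>2 / 4 + b\<^sup>2 + s * b"
      by (simp add: power2_eq_square field_simps)
    moreover have "E \<ge> s\<^sup>2 / 2 - s * b" using q by (simp add: E_def field_simps)
    moreover have "s * b\<^sup>2 \<ge> 0" "s\<^sup>2 \<ge> 0" using s0 by auto
    ultimately show ?thesis unfolding E_def[symmetric] by linarith
  qed
  also have "\<dots> \<le> (\<Prod>j<d. 1 + a j) * (1 + b)\<^sup>2"
    using prod_one_plus_ge[of "{..<d}" a] a0 unfolding s_def q_def by (intro mult_right_mono) auto
  also have "s / 2 + b = real d * (real d - 2) * (real d + 2) / 12 * t"
    by (simp add: s b_def field_simps)
  finally show ?thesis by (simp add: a_def b_def)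
qed

lemma node_inequality:
  fixes w :: real
  assumes "w > 0" "d \<ge> 2" "P \<ge> 0"
    and P: "P\<^sup>2 = (\<Prod>j<d. w + real j * (real d - 1 - real j))"
  shows "P * (w + real d * (real d - 2) / 4) \<ge>
    w powr (real d / 2) * (w + real d * (real d - 2) * (real d + 2) / 12)"
proof (rule power2_le_imp_le)
  \<comment> \<open>Dividing by \<open>w\<close> gives the form in which the first-order terms can be compared.\<close>
  define t where "t = 1 / w"
  have wt: "w * t = 1" and t: "t \<ge> 0" using assms by (auto simp: t_def)
  have scale: "w + c = w * (1 + c * t)" for c
    using wt by (simp add: algebra_simps)
  have d2: "real d \<ge> 2" using assms by simp
  have "(w powr (real d / 2))\<^sup>2 = w ^ d"
    using assms by (simp add: powr_powr powr_realpow flip: powr_numeral)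
  then have "(w powr (real d / 2) * (w + real d * (real d - 2) * (real d + 2) / 12))\<^sup>2
    = w ^ d * w\<^sup>2 * (1 + real d * (real d - 2) * (real d + 2) / 12 * t)\<^sup>2"
    by (simp only: scale power_mult_distrib mult_ac)
  also have "\<dots> \<le> w ^ d * w\<^sup>2 * ((\<Prod>j<d. 1 + t * (real j * (real d - 1 - real j))) *
       (1 + real d * (real d - 2) / 4 * t)\<^sup>2)"
    using node_inequality_scaled[OF t assms(2)] assms by (intro mult_left_mono) auto
  also have "\<dots> = (P * (w + real d * (real d - 2) / 4))\<^sup>2"
  proof -
    have "P\<^sup>2 = w ^ d * (\<Prod>j<d. 1 + t * (real j * (real d - 1 - real j)))"
      unfolding P scale prod.distrib by (simp add: mult_ac)
    then show ?thesis by (simp only: scale power_mult_distrib mult_ac)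
  qed
  finally show "(w powr (real d / 2) * (w + real d * (real d - 2) * (real d + 2) / 12))\<^sup>2
     \<le> (P * (w + real d * (real d - 2) / 4))\<^sup>2" .
  show "0 \<le> P * (w + real d * (real d - 2) / 4)" using assms d2 by simp
qed

section \<open>From the eigenvalues to all energies\<close>

text \<open>
  The origin has to be included because 0 is the lowest eigenvalue.
\<close>

lemma powr_convex_nonneg:
  assumes "p \<ge> 1"
  shows "convex_on {0..} (\<lambda>x::real. x powr p)"
proof (rule convex_onI)
  fix t x y :: real
  assume t: "0 < t" "t < 1" and xy: "x \<in> {0..}" "y \<in> {0..}"
  have le: "u powr p \<le> u" if "0 < u" "u < 1" for u :: real
    using powr_mono'[of 1 p u] that assms by simp
  show "((1 - t) *\<^sub>R x + t *\<^sub>R y) powr p \<le> (1 - t) * x powr p + t * y powr p"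
  proof (cases "x = 0 \<or> y = 0")
    case True
    then show ?thesis
      using t xy le[of t] le[of "1 - t"] assms by (auto simp: powr_mult intro!: mult_right_mono)
  next
    case False
    then show ?thesis
      using convex_onD[OF powr_convex[OF assms], of t x y] t xy by simp
  qed
qed auto

lemma affine_ge_convex_between:
  fixes f :: "real \<Rightarrow> real"
  assumes "convex_on S f" "a \<in> S" "b \<in> S" "a \<le> z" "z \<le> b" "a < b"
    and "f a \<le> N * a - M" "f b \<le> N * b - M"
  shows "f z \<le> N * z - M"
proof -
  define t where "t = (z - a) / (b - a)"
  have t: "0 \<le> t" "t \<le> 1" using assms by (auto simp: t_def)
  have z: "z = (1 - t) * a + t * b"
  proof -
    have "t * (b - a) = z - a" using assms(6) by (simp add: t_def)
    then show ?thesis by (simp add: algebra_simps)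
  qed
  have "f z \<le> (1 - t) * f a + t * f b"
    using convex_onD[OF assms(1) t assms(2,3)] z by simp
  also have "\<dots> \<le> (1 - t) * (N * a - M) + t * (N * b - M)"
    using assms t by (intro add_mono mult_left_mono) auto
  also have "\<dots> = N * z - M" unfolding z by (simp add: algebra_simps)
  finally show ?thesis .
qed

lemma riesz_sum_lower_bound:
  assumes "d \<ge> 2" "z > 0"
  defines "ev k \<equiv> real k * (real k + real d - 1)"
  shows "\<exists>L. 4 / ((real d + 2) * fact d) * (z powr (real d / 2 + 1) *
      (1 + real d * (real d - 2) * (real d + 2) / (12 * z))) \<le>
    (\<Sum>k<L. real (harmonic_dim d k) * (z - ev k))"
proof -
  define K where "K = 4 / ((real d + 2) * fact d)"
  \<comment> \<open>Splitting off \<open>D\<close> shows convexity, and makes sense of the bound at the eigenvalue 0.\<close>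
  define D where "D = real d * (real d - 2) * (real d + 2) / 12"
  define f where "f x = K * (x powr (real d / 2 + 1) + D * x powr (real d / 2))" for x
  have K: "K \<ge> 0" and D: "D \<ge> 0" using assms(1) by (auto simp: K_def D_def)
  have conv: "convex_on {0..} f"
    unfolding f_def using assms(1) K D
    by (intro convex_on_cmul convex_on_add powr_convex_nonneg) auto
  have mono: "strict_mono ev"
    using assms(1) by (intro strict_monoI_Suc) (simp add: ev_def algebra_simps)
  have ev0: "ev 0 = 0" by (simp add: ev_def)
  have ev_nonneg: "ev k \<ge> 0" for k
    using strict_mono_mono[OF mono] ev0 by (metis le0 monoD)
  have node: "f (ev l) \<le> (\<Sum>k<l. real (harmonic_dim d k) * (ev l - ev k))" for l
  proof (cases "l = 0")
    case True
    then show ?thesis by (simp add: ev0 f_def)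
  next
    case False
    then have pos: "ev l > 0" using mono ev0 by (metis strict_mono_less gr0I)
    have "f (ev l) = K * (ev l powr (real d / 2) * (ev l + D))"
      using pos by (simp add: f_def powr_add algebra_simps)
    also have "\<dots> \<le> K * (pochhammer (real l) d * (ev l + real d * (real d - 2) / 4))"
      unfolding D_def
      by (intro mult_left_mono node_inequality pos assms(1) K pochhammer_nonneg)
        (use False in \<open>auto simp: pochhammer_square ev_def\<close>)
    also have "\<dots> = (\<Sum>k<l. real (harmonic_dim d k) * (ev l - ev k))"
      unfolding K_def ev_def using assms(1) by (subst riesz_sum_at_node) auto
    finally show ?thesis .
  qed
  obtain l where l: "ev l \<le> z" "z \<le> ev (Suc l)"
  proof -
    define n where "n = (LEAST n. z \<le> ev n)"
    obtain m where "z \<le> real m" using real_arch_simple by blast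
    also have "real m \<le> ev m"
    proof (cases "m = 0")
      case False
      then have "real m * 1 \<le> real m * (real m + real d - 1)"
        using assms(1) by (intro mult_left_mono) auto
      then show ?thesis by (simp add: ev_def)
    qed (simp add: ev_def)
    finally have n: "z \<le> ev n" unfolding n_def by (rule LeastI)
    with assms(2) ev0 obtain l where "n = Suc l" by (cases n) auto
    moreover have "l < n" using calculation by simp
    then have "\<not> z \<le> ev l" unfolding n_def by (rule not_less_Least)
    ultimately show ?thesis using n by (intro that) auto
  qed
  define N where "N = (\<Sum>k<Suc l. real (harmonic_dim d k))"
  define M where "M = (\<Sum>k<Suc l. real (harmonic_dim d k) * ev k)"
  have NM: "(\<Sum>k<Suc l. real (harmonic_dim d k) * (x - ev k)) = N * x - M" for x
    unfolding N_def M_def by (simp only: right_diff_distrib sum_subtractf sum_distrib_right)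
  have "f z \<le> N * z - M"
  proof (rule affine_ge_convex_between[OF conv _ _ l])
    show "ev l < ev (Suc l)" using mono by (simp add: strict_mono_less)
    \<comment> \<open>At the node \<open>l\<close> the last summand vanishes.\<close>
    show "f (ev l) \<le> N * ev l - M" using node[of l] unfolding NM[symmetric] by simp
    \<comment> \<open>The sum up to \<open>l\<close> is also the sum belonging to the node \<open>l + 1\<close>.\<close>
    show "f (ev (Suc l)) \<le> N * ev (Suc l) - M" using node[of "Suc l"] unfolding NM .
  qed (auto simp: ev_nonneg)
  moreover have "f z = K * (z powr (real d / 2 + 1) * (1 + real d * (real d - 2) * (real d + 2) / (12 * z)))"
  proof -
    define y where "y = z powr (real d / 2)"
    have "z powr (real d / 2 + 1) = y * z" using assms(2) by (simp add: powr_add y_def)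
    then show ?thesis
      using assms(2) unfolding f_def y_def[symmetric] by (simp add: D_def field_simps)
  qed
  ultimately show ?thesis unfolding K_def NM[symmetric] by metis
qed

section \<open>The semiclassical constant\<close>

text \<open>
  The duplication formula for the Gamma function at half-integers: raising \<open>d\<close> by one exchanges
  the two factors, up to one step of the functional equation.
\<close>

lemma Gamma_half_integer_product:
  "Gamma (1 + real d / 2) * Gamma (1 / 2 + real d / 2) * 2 ^ d = sqrt pi * fact d"
proof (induction d)
  case 0
  then show ?case by (simp add: Gamma_one_half_real)
next
  case (Suc d)
  have "Gamma (1 + real (Suc d) / 2) = Gamma ((1 / 2 + real d / 2) + 1)"
    by (simp add: add_divide_distrib algebra_simps)
  also have "\<dots> = (1 / 2 + real d / 2) * Gamma (1 / 2 + real d / 2)"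
    by (rule Gamma_plus1) auto
  finally have "Gamma (1 + real (Suc d) / 2) = (1 / 2 + real d / 2) * Gamma (1 / 2 + real d / 2)" .
  moreover have "Gamma (1 / 2 + real (Suc d) / 2) = Gamma (1 + real d / 2)"
    by (simp add: add_divide_distrib algebra_simps)
  ultimately have "Gamma (1 + real (Suc d) / 2) * Gamma (1 / 2 + real (Suc d) / 2) * 2 ^ Suc d
    = (1 + real d) * (Gamma (1 + real d / 2) * Gamma (1 / 2 + real d / 2) * 2 ^ d)"
    by (simp only:) (simp add: field_simps)
  then show ?case by (simp add: Suc.IH)
qed

text \<open>
  The cone over the unit sphere is the closed unit ball.
\<close>

lemma unit_sphere_area_eq:
  "unit_sphere_area TYPE('n::finite) = real CARD('n) * unit_ball_vol (real CARD('n))"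
proof -
  have "{t *\<^sub>R x | t x. t \<in> {0..1} \<and> x \<in> sphere (0 :: real^'n) 1} = cball 0 1"
  proof (intro equalityI subsetI)
    fix y :: "real^'n" assume y: "y \<in> cball 0 1"
    show "y \<in> {t *\<^sub>R x | t x. t \<in> {0..1} \<and> x \<in> sphere 0 1}"
    proof (cases "y = 0")
      case True
      then show ?thesis
        by (intro CollectI exI[of _ 0] exI[of _ "axis undefined 1"]) (auto simp: norm_axis_1)
    next
      case False
      with y show ?thesis
        by (intro CollectI exI[of _ "norm y"] exI[of _ "y /\<^sub>R norm y"]) auto
    qed
  qed auto
  then show ?thesis
    by (simp add: unit_sphere_area_def sphere_surface_measure_def content_cball measure_completion)
qed

lemma semiclassical_const_times_area:
  assumes "CARD('n::finite) = d + 1"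
  shows "semiclassical_const 1 d * unit_sphere_area TYPE('n) = 4 / ((real d + 2) * fact d)"
proof -
  define A where "A = Gamma (1 + real d / 2)"
  define B where "B = Gamma (1 / 2 + real d / 2)"
  have pos: "A > 0" "B > 0" by (auto simp: A_def B_def intro!: Gamma_real_pos)
  have AB: "A * B * 2 ^ d = sqrt pi * fact d"
    unfolding A_def B_def by (rule Gamma_half_integer_product)
  have G1: "Gamma (1 + 1 + real d / 2) = (1 + real d / 2) * A"
  proof -
    have "Gamma (1 + 1 + real d / 2) = Gamma ((1 + real d / 2) + 1)" by (simp add: add_ac)
    also have "\<dots> = (1 + real d / 2) * A" unfolding A_def by (rule Gamma_plus1) auto
    finally show ?thesis .
  qed
  have "Gamma ((real d + 1) / 2 + 1) = Gamma ((1 / 2 + real d / 2) + 1)"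
    by (simp add: add_divide_distrib add_ac)
  also have "\<dots> = (1 / 2 + real d / 2) * B"
    unfolding B_def by (rule Gamma_plus1) auto
  finally have G2: "Gamma ((real d + 1) / 2 + 1) = (1 / 2 + real d / 2) * B" .
  have "(4 * pi) powr (- real d / 2) * pi powr ((real d + 1) / 2) = sqrt pi / 2 ^ d"
  proof -
    have "(4 * pi) powr (- real d / 2) = 4 powr (- real d / 2) * pi powr (- real d / 2)"
      by (rule powr_mult)
    moreover have "(4 :: real) powr (- real d / 2) = 1 / 2 ^ d"
    proof -
      have "(4 :: real) powr (- real d / 2) = (2 powr 2) powr (- real d / 2)" by simp
      also have "\<dots> = 2 powr (- real d)" by (simp only: powr_powr) simp
      finally show ?thesis by (simp add: powr_minus powr_realpow divide_simps)
    qed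
    moreover have "pi powr (- real d / 2) * pi powr ((real d + 1) / 2) = sqrt pi"
      by (simp add: powr_add[symmetric] powr_half_sqrt add_divide_distrib)
    ultimately show ?thesis by simp
  qed
  note pw = this
  have S: "semiclassical_const 1 d = (4 * pi) powr (- real d / 2) * (1 / ((1 + real d / 2) * A))"
    using Gamma_fact[of 1, where 'a = real] by (simp add: semiclassical_const_def G1[simplified])
  have U: "unit_sphere_area TYPE('n) =
      (real d + 1) * (pi powr ((real d + 1) / 2) / ((1 / 2 + real d / 2) * B))"
    using assms G2 by (simp add: unit_sphere_area_eq unit_ball_vol_def add.commute[of 1 "real d"])
  have "semiclassical_const 1 d * unit_sphere_area TYPE('n) =
      ((4 * pi) powr (- real d / 2) * pi powr ((real d + 1) / 2)) *
      ((real d + 1) / ((1 + real d / 2) * A * ((1 / 2 + real d / 2) * B)))"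
    unfolding S U by simp
  also have "\<dots> = sqrt pi / 2 ^ d * ((real d + 1) / ((1 + real d / 2) * A * ((1 / 2 + real d / 2) * B)))"
    unfolding pw ..
  also have "\<dots> = 4 * sqrt pi / ((real d + 2) * (A * B * 2 ^ d))"
    using pos by (simp add: divide_simps) algebra
  also have "\<dots> = 4 / ((real d + 2) * fact d)"
    unfolding AB by simp
  finally show ?thesis .
qed

section \<open>The Riesz mean bound\<close>

theorem theorem4p1p3:
  fixes d :: nat and z :: real
  assumes "d \<ge> 2"
    and "CARD('n::finite) = d + 1"
    and "z > 0"
  shows "sphere_riesz_mean1 TYPE('n) z \<ge>
    ennreal (semiclassical_const 1 d * unit_sphere_area TYPE('n) * z powr (real d / 2 + 1) *
      (1 + real d * (real d - 2) * (real d + 2) / (12 * z)))"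
proof -
  obtain L where "4 / ((real d + 2) * fact d) * (z powr (real d / 2 + 1) *
      (1 + real d * (real d - 2) * (real d + 2) / (12 * z))) \<le>
    (\<Sum>k<L. real (harmonic_dim d k) * (z - real k * (real k + real d - 1)))"
    using riesz_sum_lower_bound[OF assms(1,3)] by blast
  then have "ennreal (semiclassical_const 1 d * unit_sphere_area TYPE('n) * z powr (real d / 2 + 1) *
      (1 + real d * (real d - 2) * (real d + 2) / (12 * z))) \<le>
    ennreal (\<Sum>k<L. real (harmonic_dim d k) * (z - real k * (real k + real d - 1)))"
    unfolding semiclassical_const_times_area[OF assms(2)] by (intro ennreal_leI) (simp only: mult.assoc)
  also have "\<dots> \<le> sphere_riesz_mean1 TYPE('n) z"
    using assms(1) by (intro riesz_mean_lower_bound[OF assms(2)]) simp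
  finally show ?thesis .
qed

end
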